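(* Let $X=\begin{bmatrix}A&B\\C&D\end{bmatrix}\in\mathbb{R}^{n\times n}$, where $A\in\mathbb{R}^{m\times m}$ and $D\in\mathbb{R}^{(n-m)\times(n-m)}$. Let $A=U_A\Lambda_AV_A^*$, $D=U_D\Lambda_DV_D^*$ and $X=U_X\Lambda_XV_X^*$ be singular value decompositions of $A$, $D$ and $X$ respectively. Then $$\left\|\begin{bmatrix}A&B\\C&D\end{bmatrix}\right\|_*\ \ge\ \left\|\begin{bmatrix}A&\mathbf{0}\\\mathbf{0}&D\end{bmatrix}\right\|_*.$$ Moreover, equality holds if and only if there exists a matrix $Q$ such that $Q^*Q=I$, $$U_X=\begin{bmatrix}U_A&\mathbf{0}\\\mathbf{0}&U_D\end{bmatrix}Q\qquad\text{and}\qquad V_X=\begin{bmatrix}V_A&\mathbf{0}\\\mathbf{0}&V_D\end{bmatrix}Q.$$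
   Context: $\|\cdot\|_*$ is the nuclear norm (sum of singular values) and $^*$ the conjugate transpose (equal to the transpose for real matrices). Singular value decompositions are compact: for a real matrix $M$ of rank $k$, $M=U_M\Lambda_MV_M^*$ where $U_M$ and $V_M$ are real with $k$ orthonormal columns and $\Lambda_M\in\mathbb{R}^{k\times k}$ is diagonal with the positive singular values of $M$ on its diagonal. Thus $Q$ has $\mathrm{rank}(A)+\mathrm{rank}(D)$ rows and $\mathrm{rank}(X)$ columns, and $I$ is the identity matrix of size $\mathrm{rank}(X)$. *)

theory Defs
  imports
    "Jordan_Normal_Form.DL_Rank"
    "Jordan_Normal_Form.Char_Poly"
    "HOL-Library.Multiset"
begin

abbreviation mat_rank :: "real mat \<Rightarrow> nat" where
  "mat_rank M \<equiv> vec_space.rank (dim_row M) M"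

(* All dim_col M singular values, with multiplicity and including zeros: the square roots of the
   eigenvalues of the symmetric positive semidefinite matrix M\<^sup>T M, whose characteristic
   polynomial splits over the reals. For dim_row M < dim_col M this lists more zeros than the
   convention with min (dim_row M) (dim_col M) singular values; the nuclear norm and the positive
   singular values are unaffected. *)
definition singular_values :: "real mat \<Rightarrow> real multiset" where
  "singular_values M = image_mset sqrt (proots (char_poly (transpose_mat M * M)))"

definition nuclear_norm :: "real mat \<Rightarrow> real" where
  "nuclear_norm M = sum_mset (singular_values M)"

(* The singular values may appear on the diagonal of S in any order. *)
definition compact_svd :: "real mat \<Rightarrow> real mat \<Rightarrow> real mat \<Rightarrow> real mat \<Rightarrow> bool" where
  "compact_svd M U S V \<longleftrightarrow>
     U \<in> carrier_mat (dim_row M) (mat_rank M) \<and>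
     S \<in> carrier_mat (mat_rank M) (mat_rank M) \<and>
     V \<in> carrier_mat (dim_col M) (mat_rank M) \<and>
     transpose_mat U * U = 1\<^sub>m (mat_rank M) \<and>
     transpose_mat V * V = 1\<^sub>m (mat_rank M) \<and>
     diagonal_mat S \<and>
     mset (diag_mat S) = filter_mset (\<lambda>s. s > 0) (singular_values M) \<and>
     M = U * S * transpose_mat V"

end

theory Submission
  imports Defs
begin

text \<open>
  Let \<open>W\<close> be the block diagonal matrix with blocks \<open>U\<^sub>A\<close>, \<open>U\<^sub>D\<close> and \<open>Z\<close> the one with blocks
  \<open>V\<^sub>A\<close>, \<open>V\<^sub>D\<close>; both have orthonormal columns.  The argument computes the trace of
  \<open>W\<^sup>T X Z\<close> in two ways.

  Blockwise, the blocks \<open>B\<close> and \<open>C\<close> of \<open>X\<close> end up off the diagonal of \<open>W\<^sup>T X Z\<close>, while the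
  diagonal blocks are \<open>U\<^sub>A\<^sup>T A V\<^sub>A = S\<^sub>A\<close> and \<open>U\<^sub>D\<^sup>T D V\<^sub>D = S\<^sub>D\<close>.  So the trace is the sum
  of the nuclear norms of \<open>A\<close> and \<open>D\<close>, which is the nuclear norm of the block diagonal matrix
  (\<open>trace_block_sandwich\<close>, \<open>nuclear_norm_block_diagonal\<close>).

  Spectrally, if the columns of \<open>U\<^sub>X\<close> and \<open>V\<^sub>X\<close> are \<open>u\<^sub>i\<close> and \<open>v\<^sub>i\<close> and the singular values are
  \<open>s\<^sub>i > 0\<close>, then the trace is the sum of \<open>s\<^sub>i (a\<^sub>i \<bullet> b\<^sub>i)\<close>, where \<open>a\<^sub>i = W\<^sup>T u\<^sub>i\<close> and
  \<open>b\<^sub>i = Z\<^sup>T v\<^sub>i\<close>.  The identity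
  \<open>2 (1 - a \<bullet> b) = |a - b|\<^sup>2 + |u - W a|\<^sup>2 + |v - Z b|\<^sup>2\<close> (\<open>alignment_defect\<close>) shows that every
  factor \<open>a\<^sub>i \<bullet> b\<^sub>i\<close> is at most 1, which is the inequality.  It also settles equality: all
  the \<open>s\<^sub>i\<close> being positive, the trace equals the nuclear norm of \<open>X\<close> exactly when the three squares
  vanish for all \<open>i\<close>, that is, when \<open>W\<^sup>T U\<^sub>X\<close> and \<open>Z\<^sup>T V\<^sub>X\<close> are one matrix \<open>Q\<close> with
  \<open>U\<^sub>X = W Q\<close> and \<open>V\<^sub>X = Z Q\<close>.  This half holds for arbitrary orthonormal frames
  (\<open>trace_frames_le_nuclear_norm\<close>).
\<close>

section \<open>Singular values\<close>

lemma scalar_prod_self_real: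
  fixes v :: "real vec"
  shows "0 \<le> v \<bullet> v" and "v \<in> carrier_vec n \<Longrightarrow> v \<bullet> v = 0 \<longleftrightarrow> v = 0\<^sub>v n"
proof -
  have c: "conjugate v = v"
    by (rule eq_vecI) auto
  show "0 \<le> v \<bullet> v"
    using conjugate_square_ge_0_vec[of v] c by simp
  show "v \<in> carrier_vec n \<Longrightarrow> v \<bullet> v = 0 \<longleftrightarrow> v = 0\<^sub>v n"
    using conjugate_square_eq_0_vec[of v n] c by simp
qed

lemma char_poly_neq_0:
  fixes A :: "'a :: comm_ring_1 mat"
  assumes "A \<in> carrier_mat n n"
  shows "char_poly A \<noteq> 0"
  using degree_monic_char_poly[OF assms] by auto

lemma char_poly_block_upper_triangular:
  fixes A :: "'a :: idom mat"
  assumes A: "A \<in> carrier_mat n n" and B: "B \<in> carrier_mat n k" and D: "D \<in> carrier_mat k k"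
  shows "char_poly (four_block_mat A B (0\<^sub>m k n) D) = char_poly A * char_poly D"
proof -
  have "char_poly_matrix (four_block_mat A B (0\<^sub>m k n) D)
      = four_block_mat (char_poly_matrix A) (map_mat (\<lambda>a. [:- a:]) B) (0\<^sub>m k n) (char_poly_matrix D)"
    unfolding char_poly_matrix_def
    by (rule eq_matI) (use A B D in \<open>auto simp: one_poly_def\<close>)
  then show ?thesis
    unfolding char_poly_def
    by (simp add: det_four_block_mat_lower_left_zero[of _ n _ k] A B D)
qed

text \<open>
  For an eigenvector \<open>v\<close> of the Gram matrix with eigenvalue \<open>k\<close>, \<open>k |v|\<^sup>2 = |M v|\<^sup>2\<close>.  Since the
  real square root is odd, nonnegativity of \<open>k\<close> is what makes the singular values nonnegative.
\<close>

lemma singular_values_nonneg: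
  assumes "s \<in># singular_values M"
  shows "0 \<le> s"
proof -
  let ?n = "dim_col M" and ?G = "transpose_mat M * M"
  have M: "M \<in> carrier_mat (dim_row M) ?n" and G: "?G \<in> carrier_mat ?n ?n"
    by (auto intro: carrier_matI)
  from assms obtain k where k: "k \<in># proots (char_poly ?G)" and s: "s = sqrt k"
    unfolding singular_values_def by auto
  from k have "poly (char_poly ?G) k = 0"
    using char_poly_neq_0[OF G] by simp
  then obtain v where v: "v \<in> carrier_vec ?n" "v \<noteq> 0\<^sub>v ?n" and ev: "?G *\<^sub>v v = k \<cdot>\<^sub>v v"
    using eigenvalue_root_char_poly[OF G] G
    unfolding eigenvalue_def eigenvector_def by auto
  have "k * (v \<bullet> v) = (?G *\<^sub>v v) \<bullet> v"
    using v by (simp add: ev)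
  also have "\<dots> = (transpose_mat M *\<^sub>v (M *\<^sub>v v)) \<bullet> v"
    by (subst assoc_mult_mat_vec[OF _ M v(1)]) (use M in auto)
  also have "\<dots> = (M *\<^sub>v v) \<bullet> (M *\<^sub>v v)"
    by (rule transpose_vec_mult_scalar[OF M v(1)]) (rule mult_mat_vec_carrier[OF M v(1)])
  finally have "0 \<le> k * (v \<bullet> v)"
    using scalar_prod_self_real(1) by simp
  moreover have "0 < v \<bullet> v"
    using scalar_prod_self_real[of v] v by (simp add: less_le)
  ultimately show ?thesis
    by (simp add: s zero_le_mult_iff)
qed

text \<open>
  The diagonal of \<open>S\<close> lists only the positive singular values; the remaining ones are zero and do
  not contribute to the nuclear norm.
\<close>

lemma nuclear_norm_compact_svd:
  assumes "compact_svd M U S V"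
  shows "nuclear_norm M = sum_list (diag_mat S)"
proof -
  let ?sv = "singular_values M"
  have "?sv = filter_mset (\<lambda>s. s > 0) ?sv + filter_mset (\<lambda>s. \<not> s > 0) ?sv"
    by (rule multiset_partition)
  moreover have "filter_mset (\<lambda>s. \<not> s > 0) ?sv = filter_mset (\<lambda>s. s = 0) ?sv"
    by (rule filter_mset_cong) (use singular_values_nonneg in force)+
  ultimately have "sum_mset ?sv = sum_mset (filter_mset (\<lambda>s. s > 0) ?sv) + sum_mset (filter_mset (\<lambda>s. s = 0) ?sv)"
    by (metis sum_mset.union)
  moreover have "sum_mset (filter_mset (\<lambda>s. s = 0) ?sv) = 0"
    by (rule sum_mset.neutral) auto
  ultimately show ?thesis
    using assms unfolding nuclear_norm_def compact_svd_def by (metis add_0_right sum_mset_sum_list)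
qed

lemma compact_svd_diag_pos:
  assumes "compact_svd M U S V" and "i < mat_rank M"
  shows "0 < S $$ (i, i)"
proof -
  have S: "S \<in> carrier_mat (mat_rank M) (mat_rank M)"
    using assms(1) unfolding compact_svd_def by blast
  have "S $$ (i, i) \<in> set (diag_mat S)"
    using S assms(2) by (auto simp: diag_mat_def)
  then show ?thesis
    using assms(1) unfolding compact_svd_def
    by (metis (mono_tags, lifting) filter_mset_eq_conv set_mset_mset)
qed

text \<open>
  The Gram matrix of a block diagonal matrix is block diagonal, so its characteristic polynomial
  factors and the singular values of the two blocks are merely put together.
\<close>

lemma nuclear_norm_block_diagonal:
  assumes A: "A \<in> carrier_mat r n" and D: "D \<in> carrier_mat q k"
  shows "nuclear_norm (four_block_mat A (0\<^sub>m r k) (0\<^sub>m q n) D) = nuclear_norm A + nuclear_norm D"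
proof -
  let ?M = "four_block_mat A (0\<^sub>m r k) (0\<^sub>m q n) D"
  let ?GA = "transpose_mat A * A" and ?GD = "transpose_mat D * D"
  have G: "?GA \<in> carrier_mat n n" "?GD \<in> carrier_mat k k"
    using A D by auto
  have "transpose_mat ?M * ?M = four_block_mat ?GA (0\<^sub>m n k) (0\<^sub>m k n) ?GD"
    using A D
    by (simp add: transpose_four_block_mat[of _ r n _ k _ q] mult_four_block_mat[of _ n r _ q _ k _ _ n _ k])
  then have "char_poly (transpose_mat ?M * ?M) = char_poly ?GA * char_poly ?GD"
    using char_poly_block_upper_triangular[OF G(1) _ G(2)] by simp
  then have "singular_values ?M = singular_values A + singular_values D"
    unfolding singular_values_def
    by (simp add: proots_mult char_poly_neq_0[OF G(1)] char_poly_neq_0[OF G(2)])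
  then show ?thesis
    by (simp add: nuclear_norm_def)
qed

section \<open>Orthonormal frames aligned with singular vectors\<close>

lemma orthonormal_columns:
  assumes "U \<in> carrier_mat n k" and "transpose_mat U * U = 1\<^sub>m k" and "i < k"
  shows "col U i \<bullet> col U i = (1 :: real)"
proof -
  have "(transpose_mat U * U) $$ (i, i) = 1"
    using assms by simp
  then show ?thesis
    using assms(1,3) by simp
qed

text \<open>
  Pythagoras: \<open>W a\<close> is the orthogonal projection of \<open>u\<close> onto the column space of \<open>W\<close>, and it has
  the length of its coordinate vector \<open>a\<close>.
\<close>

lemma projection_residual:
  fixes W :: "real mat"
  assumes W: "W \<in> carrier_mat n p" and orth: "transpose_mat W * W = 1\<^sub>m p"
    and u: "u \<in> carrier_vec n"
  defines "a \<equiv> transpose_mat W *\<^sub>v u"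
  shows "(u - W *\<^sub>v a) \<bullet> (u - W *\<^sub>v a) = u \<bullet> u - a \<bullet> a"
proof -
  have a: "a \<in> carrier_vec p" and Wa: "W *\<^sub>v a \<in> carrier_vec n"
    using W u by (auto simp: a_def)
  have "a \<bullet> a = u \<bullet> (W *\<^sub>v a)"
    using transpose_vec_mult_scalar[OF W a u] by (simp add: a_def)
  moreover have "(W *\<^sub>v a) \<bullet> (W *\<^sub>v a) = a \<bullet> a"
  proof -
    have "transpose_mat W *\<^sub>v (W *\<^sub>v a) = (transpose_mat W * W) *\<^sub>v a"
      using W a by (simp add: assoc_mult_mat_vec[of _ p n _ p] del: assoc_mult_mat_vec)
    also have "\<dots> = a"
      using a by (simp add: orth)
    finally show ?thesis
      using transpose_vec_mult_scalar[OF W a Wa] by simp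
  qed
  moreover have "(W *\<^sub>v a) \<bullet> u = u \<bullet> (W *\<^sub>v a)"
    by (rule comm_scalar_prod[OF Wa u])
  moreover have "(u - W *\<^sub>v a) \<bullet> (u - W *\<^sub>v a)
      = (u \<bullet> u - (W *\<^sub>v a) \<bullet> u) - (u \<bullet> (W *\<^sub>v a) - (W *\<^sub>v a) \<bullet> (W *\<^sub>v a))"
    using u Wa
    by (simp add: minus_scalar_prod_distrib[of _ n] scalar_prod_minus_distrib[of _ n])
  ultimately show ?thesis
    by simp
qed

text \<open>
  A quantitative Cauchy-Schwarz inequality: the gap \<open>2 (1 - a \<bullet> b)\<close> is a sum of three squares, one
  for each of the ways in which alignment can fail, namely \<open>u\<close> or \<open>v\<close> leaving the column space of its
  frame, or their coordinates being different.
\<close>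

lemma alignment_defect:
  fixes W Z :: "real mat"
  assumes W: "W \<in> carrier_mat n p" "transpose_mat W * W = 1\<^sub>m p"
    and Z: "Z \<in> carrier_mat q p" "transpose_mat Z * Z = 1\<^sub>m p"
    and u: "u \<in> carrier_vec n" "u \<bullet> u = 1" and v: "v \<in> carrier_vec q" "v \<bullet> v = 1"
  defines "a \<equiv> transpose_mat W *\<^sub>v u" and "b \<equiv> transpose_mat Z *\<^sub>v v"
  shows "a \<bullet> b \<le> 1"
    and "a \<bullet> b = 1 \<Longrightarrow> a = b" and "a \<bullet> b = 1 \<Longrightarrow> u = W *\<^sub>v a" and "a \<bullet> b = 1 \<Longrightarrow> v = Z *\<^sub>v b"
proof -
  have a: "a \<in> carrier_vec p" and b: "b \<in> carrier_vec p"
    using W Z u v unfolding a_def b_def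
    by (auto intro!: mult_mat_vec_carrier[of _ p n] mult_mat_vec_carrier[of _ p q])
  let ?d = "a - b" and ?ru = "u - W *\<^sub>v a" and ?rv = "v - Z *\<^sub>v b"
  have carr: "?d \<in> carrier_vec p" "?ru \<in> carrier_vec n" "?rv \<in> carrier_vec q"
    using a b u v W Z by auto
  have "?d \<bullet> ?d = a \<bullet> a + b \<bullet> b - 2 * (a \<bullet> b)"
    using a b comm_scalar_prod[OF b a]
    by (simp add: minus_scalar_prod_distrib[of _ p] scalar_prod_minus_distrib[of _ p])
  moreover have "?ru \<bullet> ?ru = 1 - a \<bullet> a" "?rv \<bullet> ?rv = 1 - b \<bullet> b"
    using projection_residual[OF W u(1)] projection_residual[OF Z v(1)] u v
    by (simp_all add: a_def b_def)
  ultimately have defect: "2 * (1 - a \<bullet> b) = ?d \<bullet> ?d + ?ru \<bullet> ?ru + ?rv \<bullet> ?rv"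
    by simp
  note nonneg = scalar_prod_self_real(1)[of ?d] scalar_prod_self_real(1)[of ?ru]
    scalar_prod_self_real(1)[of ?rv]
  have "0 \<le> 2 * (1 - a \<bullet> b)"
    unfolding defect by (intro add_nonneg_nonneg nonneg)
  then show "a \<bullet> b \<le> 1"
    by simp
  assume "a \<bullet> b = 1"
  then have "?d \<bullet> ?d = 0" "?ru \<bullet> ?ru = 0" "?rv \<bullet> ?rv = 0"
    using defect nonneg by (simp_all add: add_nonneg_eq_0_iff)
  then have z: "?d = 0\<^sub>v p" "?ru = 0\<^sub>v n" "?rv = 0\<^sub>v q"
    using scalar_prod_self_real(2) carr by blast+
  have diff: "x = y" if "x - y = 0\<^sub>v l" "x \<in> carrier_vec l" "y \<in> carrier_vec l"
    for x y :: "real vec" and l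
  proof (rule eq_vecI)
    show "x $ i = y $ i" if "i < dim_vec y" for i
      using that \<open>x - y = 0\<^sub>v l\<close> \<open>x \<in> carrier_vec l\<close> \<open>y \<in> carrier_vec l\<close>
      by (metis carrier_vecD eq_iff_diff_eq_0 index_minus_vec(1) index_zero_vec(1))
  qed (use that in auto)
  show "a = b" using diff[OF z(1) a b] .
  show "u = W *\<^sub>v a" using diff[OF z(2) u(1)] W a by auto
  show "v = Z *\<^sub>v b" using diff[OF z(3) v(1)] Z b by auto
qed

text \<open>
  The regrouping that lets the outer factors \<open>P\<close> and \<open>Z\<close> act on the singular vectors in
  \<open>U S R\<close>.
\<close>

lemma mult_mat_regroup5:
  fixes P :: "'a :: semiring_0 mat"
  assumes P: "P \<in> carrier_mat n1 n2" and U: "U \<in> carrier_mat n2 n3" and S: "S \<in> carrier_mat n3 n4"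
    and R: "R \<in> carrier_mat n4 n5" and Z: "Z \<in> carrier_mat n5 n6"
  shows "P * (U * S * R) * Z = (P * U) * S * (R * Z)"
proof -
  have PU: "P * U \<in> carrier_mat n1 n3" and US: "U * S \<in> carrier_mat n2 n4"
    using P U S by auto
  have "P * (U * S * R) = P * (U * S) * R"
    by (rule assoc_mult_mat[symmetric, OF P US R])
  also have "P * (U * S) = P * U * S"
    by (rule assoc_mult_mat[symmetric, OF P U S])
  finally show ?thesis
    using assoc_mult_mat[OF mult_carrier_mat[OF PU S] R Z] by simp
qed

text \<open>
  \<open>M S N\<^sup>T\<close> is the sum of the rank-one matrices formed by the columns of \<open>M\<close> and \<open>N\<close>, weighted by the
  diagonal of \<open>S\<close>, and the trace of a rank-one matrix is a scalar product.
\<close>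

lemma trace_diagonal_sandwich:
  fixes S :: "real mat"
  assumes M: "M \<in> carrier_mat p k" and N: "N \<in> carrier_mat p k"
    and S: "S \<in> carrier_mat k k" and diag: "diagonal_mat S"
  shows "sum_list (diag_mat (M * S * transpose_mat N)) = (\<Sum>i<k. S $$ (i, i) * (col M i \<bullet> col N i))"
proof -
  have MS: "(M * S) $$ (j, i) = M $$ (j, i) * S $$ (i, i)" if "j < p" "i < k" for i j
  proof -
    have "(M * S) $$ (j, i) = (\<Sum>l\<in>{0..<k}. M $$ (j, l) * S $$ (l, i))"
      using that M S by (auto simp: scalar_prod_def)
    also have "\<dots> = (\<Sum>l\<in>{0..<k}. if l = i then M $$ (j, i) * S $$ (i, i) else 0)"
      by (rule sum.cong) (use that diag S in \<open>auto simp: diagonal_mat_def\<close>)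
    finally show ?thesis
      using that by simp
  qed
  have expand: "(Y * transpose_mat N) $$ (j, j) = (\<Sum>i\<in>{0..<k}. Y $$ (j, i) * N $$ (j, i))"
    if "Y \<in> carrier_mat p k" "j < p" for Y j
    using that N by (auto simp: scalar_prod_def)
  have "(M * S * transpose_mat N) $$ (j, j) = (\<Sum>i<k. S $$ (i, i) * (M $$ (j, i) * N $$ (j, i)))"
    if j: "j < p" for j
  proof -
    have "(M * S * transpose_mat N) $$ (j, j) = (\<Sum>i\<in>{0..<k}. (M * S) $$ (j, i) * N $$ (j, i))"
      by (rule expand[OF mult_carrier_mat[OF M S] j])
    also have "\<dots> = (\<Sum>i\<in>{0..<k}. S $$ (i, i) * (M $$ (j, i) * N $$ (j, i)))"
      by (rule sum.cong) (use j MS in auto)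
    finally show ?thesis
      by (simp add: atLeast0LessThan)
  qed
  then have "sum_list (diag_mat (M * S * transpose_mat N))
      = (\<Sum>j<p. \<Sum>i<k. S $$ (i, i) * (M $$ (j, i) * N $$ (j, i)))"
    using M by (simp add: diag_mat_def interv_sum_list_conv_sum_set_nat atLeast0LessThan)
  also have "\<dots> = (\<Sum>i<k. \<Sum>j<p. S $$ (i, i) * (M $$ (j, i) * N $$ (j, i)))"
    by (rule sum.swap)
  also have "\<dots> = (\<Sum>i<k. S $$ (i, i) * (col M i \<bullet> col N i))"
    by (rule sum.cong) (use M N in \<open>auto simp: scalar_prod_def sum_distrib_left atLeast0LessThan\<close>)
  finally show ?thesis .
qed

text \<open>
  Writing \<open>W\<^sup>T X Z = (W\<^sup>T U) S (Z\<^sup>T V)\<^sup>T\<close> turns the gap between both sides into a sum of the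
  alignment defects of the pairs of singular vectors, weighted by the singular values.  Equality
  forces every defect to vanish because only positive singular values occur, and then
  \<open>W\<^sup>T U = Z\<^sup>T V\<close> serves as \<open>Q\<close>.
\<close>

theorem trace_frames_le_nuclear_norm:
  fixes X W Z :: "real mat"
  assumes svd: "compact_svd X U S V"
    and W: "W \<in> carrier_mat (dim_row X) p" "transpose_mat W * W = 1\<^sub>m p"
    and Z: "Z \<in> carrier_mat (dim_col X) p" "transpose_mat Z * Z = 1\<^sub>m p"
  shows "sum_list (diag_mat (transpose_mat W * X * Z)) \<le> nuclear_norm X"
    and "sum_list (diag_mat (transpose_mat W * X * Z)) = nuclear_norm X \<longleftrightarrow>
      (\<exists>Q. Q \<in> carrier_mat p (mat_rank X) \<and> transpose_mat Q * Q = 1\<^sub>m (mat_rank X)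
        \<and> U = W * Q \<and> V = Z * Q)"
proof -
  let ?n = "dim_row X" and ?q = "dim_col X" and ?k = "mat_rank X"
  let ?M = "transpose_mat W * U" and ?N = "transpose_mat Z * V"
  have U: "U \<in> carrier_mat ?n ?k" "transpose_mat U * U = 1\<^sub>m ?k"
    and S: "S \<in> carrier_mat ?k ?k" "diagonal_mat S"
    and V: "V \<in> carrier_mat ?q ?k" "transpose_mat V * V = 1\<^sub>m ?k"
    and X: "X = U * S * transpose_mat V"
    using svd unfolding compact_svd_def by blast+
  have M: "?M \<in> carrier_mat p ?k" and N: "?N \<in> carrier_mat p ?k"
    using W Z U V by auto
  have "transpose_mat W * X * Z = transpose_mat W * (U * S * transpose_mat V) * Z"
    using X by simp
  also have "\<dots> = ?M * S * transpose_mat ?N"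
    using mult_mat_regroup5[of "transpose_mat W" p ?n U ?k S ?k "transpose_mat V" ?q Z p] W Z U V S
    by (simp add: transpose_mult[of _ p ?q])
  finally have trace: "sum_list (diag_mat (transpose_mat W * X * Z))
      = (\<Sum>i<?k. S $$ (i, i) * (col ?M i \<bullet> col ?N i))"
    using trace_diagonal_sandwich[OF M N S] by simp
  have norm: "nuclear_norm X = (\<Sum>i<?k. S $$ (i, i))"
    using nuclear_norm_compact_svd[OF svd] S
    by (simp add: diag_mat_def interv_sum_list_conv_sum_set_nat atLeast0LessThan)
  have colM: "col ?M i = transpose_mat W *\<^sub>v col U i" and colN: "col ?N i = transpose_mat Z *\<^sub>v col V i"
    if "i < ?k" for i
    using W Z U V that by (auto simp: col_mult2[of _ p _ _ ?k])
  have unit: "col U i \<in> carrier_vec ?n" "col U i \<bullet> col U i = 1"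
    "col V i \<in> carrier_vec ?q" "col V i \<bullet> col V i = 1" if "i < ?k" for i
    using orthonormal_columns[OF U that] orthonormal_columns[OF V that] U V that by auto
  have le1: "col ?M i \<bullet> col ?N i \<le> 1" if "i < ?k" for i
    using alignment_defect(1)[OF W Z unit[OF that]] that by (simp add: colM colN)
  have pos: "0 < S $$ (i, i)" if "i < ?k" for i
    using compact_svd_diag_pos[OF svd that] .
  have gap: "nuclear_norm X - sum_list (diag_mat (transpose_mat W * X * Z))
      = (\<Sum>i<?k. S $$ (i, i) * (1 - col ?M i \<bullet> col ?N i))"
    by (simp add: trace norm sum_subtractf algebra_simps)
  have gap_nonneg: "0 \<le> S $$ (i, i) * (1 - col ?M i \<bullet> col ?N i)" if "i \<in> {..<?k}" for i
    using that pos[of i] le1[of i] by simp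
  show "sum_list (diag_mat (transpose_mat W * X * Z)) \<le> nuclear_norm X"
    using gap sum_nonneg[of "{..<?k}" "\<lambda>i. S $$ (i, i) * (1 - col ?M i \<bullet> col ?N i)"] gap_nonneg
    by simp
  have eq_iff: "sum_list (diag_mat (transpose_mat W * X * Z)) = nuclear_norm X \<longleftrightarrow>
      (\<forall>i<?k. col ?M i \<bullet> col ?N i = 1)"
  proof -
    have "sum_list (diag_mat (transpose_mat W * X * Z)) = nuclear_norm X \<longleftrightarrow>
        (\<Sum>i<?k. S $$ (i, i) * (1 - col ?M i \<bullet> col ?N i)) = 0"
      using gap by auto
    also have "\<dots> \<longleftrightarrow> (\<forall>i\<in>{..<?k}. S $$ (i, i) * (1 - col ?M i \<bullet> col ?N i) = 0)"
      by (rule sum_nonneg_eq_0_iff) (use gap_nonneg in auto)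
    also have "\<dots> \<longleftrightarrow> (\<forall>i<?k. col ?M i \<bullet> col ?N i = 1)"
      using pos by force
    finally show ?thesis .
  qed
  show "sum_list (diag_mat (transpose_mat W * X * Z)) = nuclear_norm X \<longleftrightarrow>
      (\<exists>Q. Q \<in> carrier_mat p ?k \<and> transpose_mat Q * Q = 1\<^sub>m ?k \<and> U = W * Q \<and> V = Z * Q)"
    unfolding eq_iff
  proof
    assume aligned: "\<forall>i<?k. col ?M i \<bullet> col ?N i = 1"
    \<comment> \<open>A scalar product of 1 leaves no defect in the pair of the \<open>i\<close>-th singular vectors.\<close>
    note tight = alignment_defect(2-4)[OF W Z unit]
    have one: "(transpose_mat W *\<^sub>v col U i) \<bullet> (transpose_mat Z *\<^sub>v col V i) = 1" if "i < ?k" for i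
      using aligned that by (simp add: colM colN)
    have cols: "col ?M i = col ?N i" "col U i = W *\<^sub>v col ?M i" "col V i = Z *\<^sub>v col ?N i"
      if "i < ?k" for i
      using tight[OF that that that that one[OF that]] that by (simp_all only: colM colN)
    have MN: "?M = ?N"
      by (rule mat_col_eqI) (use cols(1) U V W Z in auto)
    have UM: "U = W * ?M"
      by (rule mat_col_eqI) (use cols(2) U M W in \<open>auto simp: col_mult2[of _ ?n p _ ?k]\<close>)
    have VM: "V = Z * ?M"
      unfolding MN
      by (rule mat_col_eqI) (use cols(3) V N Z in \<open>auto simp: col_mult2[of _ ?q p _ ?k]\<close>)
    have "transpose_mat ?M * ?M = transpose_mat U * (W * ?M)"
      using assoc_mult_mat[of "transpose_mat U" ?k ?n W p ?M ?k] U W M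
      by (simp add: transpose_mult[of _ p ?n] del: assoc_mult_mat)
    also have "\<dots> = 1\<^sub>m ?k"
      using U(2) by (simp only: flip: UM)
    finally show "\<exists>Q. Q \<in> carrier_mat p ?k \<and> transpose_mat Q * Q = 1\<^sub>m ?k \<and> U = W * Q \<and> V = Z * Q"
      using M UM VM by blast
  next
    assume "\<exists>Q. Q \<in> carrier_mat p ?k \<and> transpose_mat Q * Q = 1\<^sub>m ?k \<and> U = W * Q \<and> V = Z * Q"
    then obtain Q where Q: "Q \<in> carrier_mat p ?k" "transpose_mat Q * Q = 1\<^sub>m ?k"
      and UQ: "U = W * Q" and VQ: "V = Z * Q"
      by blast
    \<comment> \<open>The frames cancel, so both coordinate matrices are \<open>Q\<close>, whose columns are unit vectors.\<close>
    have "?M = (transpose_mat W * W) * Q"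
      unfolding UQ by (rule assoc_mult_mat[symmetric]) (use W Q in auto)
    then have MQ: "?M = Q"
      using W(2) Q by simp
    have "?N = (transpose_mat Z * Z) * Q"
      unfolding VQ by (rule assoc_mult_mat[symmetric]) (use Z Q in auto)
    then have NQ: "?N = Q"
      using Z(2) Q by simp
    show "\<forall>i<?k. col ?M i \<bullet> col ?N i = 1"
      unfolding MQ NQ using orthonormal_columns[OF Q] by simp
  qed
qed

section \<open>Pinching to the diagonal blocks\<close>

lemma compact_svd_sandwich:
  assumes "compact_svd M U S V"
  shows "transpose_mat U * M * V = S"
proof -
  let ?n = "dim_row M" and ?q = "dim_col M" and ?k = "mat_rank M"
  have U: "U \<in> carrier_mat ?n ?k" "transpose_mat U * U = 1\<^sub>m ?k"
    and S: "S \<in> carrier_mat ?k ?k"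
    and V: "V \<in> carrier_mat ?q ?k" "transpose_mat V * V = 1\<^sub>m ?k"
    and M: "M = U * S * transpose_mat V"
    using assms unfolding compact_svd_def by blast+
  have "transpose_mat U * M * V = transpose_mat U * (U * S * transpose_mat V) * V"
    using M by simp
  also have "\<dots> = (transpose_mat U * U) * S * (transpose_mat V * V)"
    by (rule mult_mat_regroup5) (use U(1) S V(1) in auto)
  finally show ?thesis
    using U(2) V(2) S by simp
qed

lemma orthonormal_block_diagonal:
  fixes P R :: "real mat"
  assumes P: "P \<in> carrier_mat n k" "transpose_mat P * P = 1\<^sub>m k"
    and R: "R \<in> carrier_mat q l" "transpose_mat R * R = 1\<^sub>m l"
  defines "W \<equiv> four_block_mat P (0\<^sub>m n l) (0\<^sub>m q k) R"
  shows "transpose_mat W * W = 1\<^sub>m (k + l)"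
  using P R unfolding W_def
  by (simp add: transpose_four_block_mat[of _ n k _ l _ q] mult_four_block_mat[of _ k n _ q _ l _ _ k _ l])

text \<open>
  Because the outer factors are block diagonal, \<open>B\<close> and \<open>C\<close> only enter the off-diagonal blocks of
  the product, which the trace ignores.
\<close>

lemma trace_block_sandwich:
  fixes A B C D :: "real mat"
  assumes A: "A \<in> carrier_mat n n'" and B: "B \<in> carrier_mat n q'"
    and C: "C \<in> carrier_mat q n'" and D: "D \<in> carrier_mat q q'"
    and P: "P \<in> carrier_mat n k" and R: "R \<in> carrier_mat q l"
    and P': "P' \<in> carrier_mat n' k" and R': "R' \<in> carrier_mat q' l"
  shows "sum_list (diag_mat (transpose_mat (four_block_mat P (0\<^sub>m n l) (0\<^sub>m q k) R)
        * four_block_mat A B C D * four_block_mat P' (0\<^sub>m n' l) (0\<^sub>m q' k) R'))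
    = sum_list (diag_mat (transpose_mat P * A * P')) + sum_list (diag_mat (transpose_mat R * D * R'))"
proof -
  have "transpose_mat (four_block_mat P (0\<^sub>m n l) (0\<^sub>m q k) R) * four_block_mat A B C D
      = four_block_mat (transpose_mat P * A) (transpose_mat P * B) (transpose_mat R * C) (transpose_mat R * D)"
    using A B C D P R
    by (simp add: transpose_four_block_mat[of _ n k _ l _ q] mult_four_block_mat[of _ k n _ q _ l _ _ n' _ q'])
  moreover have "\<dots> * four_block_mat P' (0\<^sub>m n' l) (0\<^sub>m q' k) R'
      = four_block_mat (transpose_mat P * A * P') (transpose_mat P * B * R')
          (transpose_mat R * C * P') (transpose_mat R * D * R')"
    using A B C D P R P' R'
    by (subst mult_four_block_mat[of _ k n' _ q' _ l _ _ k _ l]) auto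
  ultimately show ?thesis
    using A D P P' R R' by (simp add: diag_four_block_mat[of _ k _ l])
qed

theorem lemma3p2:
  fixes n m :: nat
    and A B C D X U\<^sub>A S\<^sub>A V\<^sub>A U\<^sub>D S\<^sub>D V\<^sub>D U\<^sub>X S\<^sub>X V\<^sub>X :: "real mat"
  assumes "m \<le> n"
    and "A \<in> carrier_mat m m"
    and "B \<in> carrier_mat m (n - m)"
    and "C \<in> carrier_mat (n - m) m"
    and "D \<in> carrier_mat (n - m) (n - m)"
    and "X = four_block_mat A B C D"
    and "compact_svd A U\<^sub>A S\<^sub>A V\<^sub>A"
    and "compact_svd D U\<^sub>D S\<^sub>D V\<^sub>D"
    and "compact_svd X U\<^sub>X S\<^sub>X V\<^sub>X"
  shows "nuclear_norm (four_block_mat A B C D)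
           \<ge> nuclear_norm (four_block_mat A (0\<^sub>m m (n - m)) (0\<^sub>m (n - m) m) D)
    \<and> (nuclear_norm (four_block_mat A B C D)
           = nuclear_norm (four_block_mat A (0\<^sub>m m (n - m)) (0\<^sub>m (n - m) m) D)
       \<longleftrightarrow> (\<exists>Q. Q \<in> carrier_mat (mat_rank A + mat_rank D) (mat_rank X)
              \<and> transpose_mat Q * Q = 1\<^sub>m (mat_rank X)
              \<and> U\<^sub>X = four_block_mat U\<^sub>A (0\<^sub>m m (mat_rank D)) (0\<^sub>m (n - m) (mat_rank A)) U\<^sub>D * Q
              \<and> V\<^sub>X = four_block_mat V\<^sub>A (0\<^sub>m m (mat_rank D)) (0\<^sub>m (n - m) (mat_rank A)) V\<^sub>D * Q))"
proof -
  let ?a = "mat_rank A" and ?d = "mat_rank D"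
  let ?W = "four_block_mat U\<^sub>A (0\<^sub>m m ?d) (0\<^sub>m (n - m) ?a) U\<^sub>D"
  let ?Z = "four_block_mat V\<^sub>A (0\<^sub>m m ?d) (0\<^sub>m (n - m) ?a) V\<^sub>D"
  have dims: "dim_row A = m" "dim_col A = m" "dim_row D = n - m" "dim_col D = n - m"
    using assms(2,5) by auto
  have U: "U\<^sub>A \<in> carrier_mat m ?a" "transpose_mat U\<^sub>A * U\<^sub>A = 1\<^sub>m ?a"
      "U\<^sub>D \<in> carrier_mat (n - m) ?d" "transpose_mat U\<^sub>D * U\<^sub>D = 1\<^sub>m ?d"
    and V: "V\<^sub>A \<in> carrier_mat m ?a" "transpose_mat V\<^sub>A * V\<^sub>A = 1\<^sub>m ?a"
      "V\<^sub>D \<in> carrier_mat (n - m) ?d" "transpose_mat V\<^sub>D * V\<^sub>D = 1\<^sub>m ?d"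
    using assms(7,8) unfolding compact_svd_def dims by blast+
  have W: "?W \<in> carrier_mat (dim_row X) (?a + ?d)" "transpose_mat ?W * ?W = 1\<^sub>m (?a + ?d)"
    using orthonormal_block_diagonal[OF U] U assms(2,5,6) by auto
  have Z: "?Z \<in> carrier_mat (dim_col X) (?a + ?d)" "transpose_mat ?Z * ?Z = 1\<^sub>m (?a + ?d)"
    using orthonormal_block_diagonal[OF V] V assms(2,5,6) by auto
  have "sum_list (diag_mat (transpose_mat ?W * X * ?Z))
      = sum_list (diag_mat (transpose_mat U\<^sub>A * A * V\<^sub>A)) + sum_list (diag_mat (transpose_mat U\<^sub>D * D * V\<^sub>D))"
    unfolding assms(6) by (rule trace_block_sandwich[OF assms(2-5) U(1,3) V(1,3)])
  also have "\<dots> = nuclear_norm A + nuclear_norm D"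
    using assms(7,8) by (simp add: compact_svd_sandwich nuclear_norm_compact_svd)
  also have "\<dots> = nuclear_norm (four_block_mat A (0\<^sub>m m (n - m)) (0\<^sub>m (n - m) m) D)"
    by (rule nuclear_norm_block_diagonal[OF assms(2,5), symmetric])
  finally have trace: "sum_list (diag_mat (transpose_mat ?W * X * ?Z))
      = nuclear_norm (four_block_mat A (0\<^sub>m m (n - m)) (0\<^sub>m (n - m) m) D)" .
  show ?thesis
    using trace_frames_le_nuclear_norm[OF assms(9) W Z]
    unfolding trace assms(6)[symmetric] by (simp add: eq_commute)
qed

end
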